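(* Let $(X,\mathcal{A})$ be a measurable space, $Y=[0,m]$ or $Y=[0,m)$ with $0<m\le\infty$, $\mu$ a monotone measure on $\mathcal{A}$, and $D\in\mathcal{A}$. Let $\star,\lozenge\colon Y^2\to Y$ and $\circ_i\colon Y\times\mu(\mathcal{A})\to Y$, $i=1,2,3$, be nondecreasing operators with $\lozenge$ right-continuous, let $\triangledown\colon\mu(\mathcal{A})^2\to\mu(\mathcal{A})$ be an operator, and let $\phi_i\colon Y\to Y$ be increasing functions with $\phi_i(Y)=Y$, $i=1,2,3$. Assume that for all $a,b\in Y$ and all $c,d\in\mu(\mathcal{A})$ with $c,d\le\mu(D)$, $$\phi_1^{-1}\big(\phi_1(a\star b)\circ_1(c\,\triangledown\, d)\big)\le\phi_2^{-1}\big(\phi_2(a)\circ_2 c\big)\ \lozenge\ \phi_3^{-1}\big(\phi_3(b)\circ_3 d\big).$$ If measurable functions $f,g\colon X\to Y$ are $\mu$-subadditive for $\triangledown$ and $D$, then $$\phi_1^{-1}\Big(⨍_{\circ_1,D}\phi_1(f\star g)\,d\mu\Big)\le\phi_2^{-1}\Big(⨍_{\circ_2,D}\phi_2(f)\,d\mu\Big)\ \lozenge\ \phi_3^{-1}\Big(⨍_{\circ_3,D}\phi_3(g)\,d\mu\Big),$$ where $⨍$ denotes the generalized lower Sugeno integral.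
   Context: A monotone measure on $\mathcal{A}$ is a nondecreasing set function $\mu\colon\mathcal{A}\to[0,\infty]$ with $\mu(\emptyset)=0$; $\mu(\mathcal{A})=\{\mu(A):A\in\mathcal{A}\}$. An operator $\circ$ is nondecreasing if $a\circ b\le x\circ y$ whenever $a\le x$, $b\le y$. $\lozenge$ is right-continuous if $\lim_{n\to\infty}(a_n\lozenge b_n)=a\lozenge b$ for all $a_n,b_n,a,b\in Y$ such that $a_n\searrow a$ and $b_n\searrow b$, where $c_n\searrow c$ means that $\lim_{n\to\infty}c_n=c$ and $c_n>c_{n+1}$ for all $n$. The generalized lower Sugeno integral of a measurable $f\colon X\to Y$ on $D$ is $⨍_{\circ,D}f\,d\mu:=\inf_{t\in Y}\{t\circ\mu(D\cap\{f>t\})\}$. Measurable functions $f,g\colon X\to Y$ are $\mu$-subadditive for $\triangledown$ and $D$ if for all $a,b\in Y$: $\mu\big(D\cap(\{f>a\}\cup\{g>b\})\big)\le\mu(D\cap\{f>a\})\,\triangledown\,\mu(D\cap\{g>b\})$. $(f\star g)(x)=f(x)\star g(x)$, which is taken to be measurable so that the integral is defined.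
   Formalization: For Y=[0,m], right-continuity of ◊ is also required at the endpoint: a_n◊m→a◊m and m◊a_n→m◊a whenever a_n↘a. With strictly decreasing sequences only, nothing is required where an argument equals m, and the inequality can fail. Nothing changes for Y=[0,m). *)

theory Defs
  imports "HOL-Analysis.Analysis"
begin

text \<open>
  Throughout, a measurable space \<open>(X, \<A>)\<close> is represented by a value \<open>M\<close> of type \<open>'a measure\<close>, of
  which only \<open>space M\<close> and \<open>sets M\<close> are used; the set function \<open>\<mu>\<close> is separate and unrelated to
  \<open>emeasure M\<close>. Partial operators are total functions whose behaviour matters only on the
  stated domains.
\<close>

definition monotone_measure :: "'a measure \<Rightarrow> ('a set \<Rightarrow> ennreal) \<Rightarrow> bool" where
  "monotone_measure M \<mu> \<longleftrightarrow> \<mu> {} = 0 \<and> mono_on (sets M) \<mu>"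

definition nondecreasing_op ::
  "ennreal set \<Rightarrow> ennreal set \<Rightarrow> (ennreal \<Rightarrow> ennreal \<Rightarrow> ennreal) \<Rightarrow> bool" where
  "nondecreasing_op A B op \<longleftrightarrow>
     (\<forall>a\<in>A. \<forall>x\<in>A. \<forall>b\<in>B. \<forall>y\<in>B. a \<le> x \<longrightarrow> b \<le> y \<longrightarrow> op a b \<le> op x y)"

text \<open>
  A sequence decreases to \<open>c\<close> if it converges to \<open>c\<close> and is strictly decreasing. No such sequence
  in \<open>Y\<close> exists when \<open>c\<close> is the greatest element of \<open>Y\<close> (the case \<open>c = m\<close>, \<open>Y = [0,m]\<close>); there
  the constant sequence takes its place, so that right-continuity at a point of the upper boundary
  is right-continuity in the other coordinate. For \<open>Y = [0,m)\<close> the second disjunct is void.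

  With strictly decreasing sequences only, right-continuity says nothing about \<open>a \<diamond> m\<close>, and the
  integral inequality can fail: let \<open>Y = [0,1]\<close>, \<open>X = [0,\<infinity>]\<close>, \<open>D = (0,1]\<close>, \<open>\<mu>(A) = 1\<close> if
  \<open>D \<subseteq> A\<close> and \<open>0\<close> otherwise, \<open>f(x) = min x 1\<close>, \<open>g = 0\<close>, \<open>a \<star> b = a\<close>, \<open>c \<nabla> d = c\<close>,
  \<open>\<phi>\<^sub>i = id\<close>, \<open>t \<circ>\<^sub>1 c = 1\<close> if \<open>max t c > 0\<close> and \<open>0\<close> otherwise, \<open>t \<circ>\<^sub>2 c = max t c\<close>,
  \<open>t \<circ>\<^sub>3 c = 1\<close>, and \<open>a \<diamond> b = 1\<close> if \<open>a > 0\<close> and \<open>b = 1\<close>, and \<open>0\<close> otherwise. The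
  integrals of \<open>f \<star> g\<close>, \<open>f\<close>, \<open>g\<close> are \<open>1\<close>, \<open>0\<close>, \<open>1\<close>, but \<open>0 \<diamond> 1 = 0\<close>.
\<close>

definition decreases_to :: "ennreal set \<Rightarrow> (nat \<Rightarrow> ennreal) \<Rightarrow> ennreal \<Rightarrow> bool" where
  "decreases_to Y s c \<longleftrightarrow>
     s \<longlonglongrightarrow> c \<and> ((\<forall>n. s n > s (Suc n)) \<or> (\<forall>y\<in>Y. y \<le> c) \<and> (\<forall>n. s n = c))"

definition right_continuous_op ::
  "ennreal set \<Rightarrow> (ennreal \<Rightarrow> ennreal \<Rightarrow> ennreal) \<Rightarrow> bool" where
  "right_continuous_op Y op \<longleftrightarrow>
     (\<forall>s t a b. (\<forall>n. s n \<in> Y) \<longrightarrow> (\<forall>n. t n \<in> Y) \<longrightarrow> a \<in> Y \<longrightarrow> b \<in> Y \<longrightarrow>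
        decreases_to Y s a \<longrightarrow> decreases_to Y t b \<longrightarrow>
        (\<lambda>n. op (s n) (t n)) \<longlonglongrightarrow> op a b)"

definition lower_sugeno_integral ::
  "ennreal set \<Rightarrow> (ennreal \<Rightarrow> ennreal \<Rightarrow> ennreal) \<Rightarrow> 'a measure \<Rightarrow> ('a set \<Rightarrow> ennreal) \<Rightarrow>
   'a set \<Rightarrow> ('a \<Rightarrow> ennreal) \<Rightarrow> ennreal" where
  "lower_sugeno_integral Y op M \<mu> D f =
     (INF t\<in>Y. op t (\<mu> (D \<inter> {x \<in> space M. f x > t})))"

definition mu_subadditive ::
  "ennreal set \<Rightarrow> 'a measure \<Rightarrow> ('a set \<Rightarrow> ennreal) \<Rightarrow> (ennreal \<Rightarrow> ennreal \<Rightarrow> ennreal) \<Rightarrow>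
   'a set \<Rightarrow> ('a \<Rightarrow> ennreal) \<Rightarrow> ('a \<Rightarrow> ennreal) \<Rightarrow> bool" where
  "mu_subadditive Y M \<mu> op D f g \<longleftrightarrow>
     (\<forall>a\<in>Y. \<forall>b\<in>Y.
        \<mu> (D \<inter> ({x \<in> space M. f x > a} \<union> {x \<in> space M. g x > b})) \<le>
        op (\<mu> (D \<inter> {x \<in> space M. f x > a})) (\<mu> (D \<inter> {x \<in> space M. g x > b})))"

end

theory Submission
  imports Defs
begin

text \<open>
  For \<open>a, b \<in> Y\<close>, monotonicity of \<open>\<star>\<close> gives
  \<open>{f \<star> g > a \<star> b} \<subseteq> {f > a} \<union> {g > b}\<close>. Evaluating the infimum on the left at \<open>\<phi>\<^sub>1(a \<star> b)\<close> and
  applying subadditivity and the hypothesis bounds the left-hand side by \<open>u \<diamond> v\<close> for all values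
  \<open>u = \<phi>\<^sub>2\<inverse>(\<phi>\<^sub>2(a) \<circ>\<^sub>2 \<mu>(D \<inter> {f > a}))\<close> and \<open>v\<close> likewise from \<open>g\<close>. The two integrals on the right
  are, after applying \<open>\<phi>\<^sub>i\<inverse>\<close>, the infima of these \<open>u\<close> and \<open>v\<close>, and right-continuity lets \<open>u\<close> and \<open>v\<close>
  descend to them.
\<close>

text \<open>Between \<open>p\<close> and \<open>y\<close> lies some \<open>z < y\<close>, which is
  finite even if \<open>y\<close> is infinite. Then \<open>p\<close> and \<open>z\<close> are reals,
  and moving from \<open>z\<close> towards \<open>p\<close> by the factors
  \<open>1 / (n + 1)\<close> gives the sequence.\<close>

lemma ennreal_strict_decreasing_sequence:
  fixes p y :: ennreal
  assumes "p < y"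
  shows "\<exists>s. (\<forall>n. p < s n \<and> s n < y) \<and> (\<forall>n. s (Suc n) < s n) \<and> s \<longlonglongrightarrow> p"
proof -
  obtain z where z: "p < z" "z < y" using assms dense by blast
  obtain r where r: "p = ennreal r" "0 \<le> r"
    using z by (cases p) auto
  obtain q where q: "z = ennreal q" "0 \<le> q"
    using z by (cases z) auto
  have "r < q" using z r q by (simp add: ennreal_less_iff)
  \<comment> \<open>At \<open>n = 0\<close> this equals \<open>q\<close>, so every term stays at or
    below \<open>z\<close>, hence strictly below \<open>y\<close>.\<close>
  define s where "s n = r + (q - r) * inverse (real (Suc n))" for n
  have s_gt: "r < s n" for n
    using \<open>r < q\<close> by (simp add: s_def)
  have s_le: "s n \<le> q" for n
  proof -
    have "(q - r) * inverse (real (Suc n)) \<le> (q - r) * 1"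
      using \<open>r < q\<close> by (intro mult_left_mono) (auto simp: divide_simps)
    then show ?thesis by (simp add: s_def)
  qed
  have s_dec: "s (Suc n) < s n" for n
    unfolding s_def using \<open>r < q\<close>
    by (intro add_strict_left_mono mult_strict_left_mono) auto
  have "s \<longlonglongrightarrow> r + (q - r) * 0"
    unfolding s_def by (intro tendsto_intros LIMSEQ_inverse_real_of_nat)
  then have "(\<lambda>n. ennreal (s n)) \<longlonglongrightarrow> p"
    unfolding r by (intro tendsto_ennrealI) simp
  moreover have "p < ennreal (s n)" for n
    using s_gt[of n] r by (simp add: ennreal_less_iff)
  moreover have "ennreal (s n) < y" for n
    using s_le[of n] z q by (meson ennreal_leI le_less_trans)
  moreover have "ennreal (s (Suc n)) < ennreal (s n)" for n
    using s_dec[of n] s_gt[of "Suc n"] r by (simp add: ennreal_less_iff)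
  ultimately show ?thesis by (intro exI[of _ "\<lambda>n. ennreal (s n)"]) blast
qed

text \<open>Supplies sequences along which right-continuity can be applied at any point of
  \<open>Y\<close>. The last disjunction is what makes them usable with infima: terms strictly above
  \<open>p\<close> leave room for an approximating value, while at the greatest element of
  \<open>Y\<close> the constant sequence dominates all of \<open>Y\<close>.\<close>

lemma decreases_to_exists:
  assumes down: "\<forall>y\<in>Y. \<forall>x\<le>y. x \<in> Y" and "p \<in> Y"
  shows "\<exists>s. (\<forall>n. s n \<in> Y) \<and> decreases_to Y s p \<and>
    ((\<forall>n. p < s n) \<or> (\<forall>n y. y \<in> Y \<longrightarrow> y \<le> s n))"
proof (cases "\<exists>y\<in>Y. p < y")
  case True
  then obtain y where y: "y \<in> Y" "p < y" by blast
  from ennreal_strict_decreasing_sequence[OF this(2)] obtain s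
    where s: "\<forall>n. p < s n \<and> s n < y" "\<forall>n. s (Suc n) < s n" "s \<longlonglongrightarrow> p" by blast
  then have "\<forall>n. s n \<in> Y" using down y(1) by (meson less_imp_le)
  then show ?thesis using s unfolding decreases_to_def by blast
next
  case False
  then have "\<forall>y\<in>Y. y \<le> p" by (simp add: not_less)
  then show ?thesis using \<open>p \<in> Y\<close>
    by (intro exI[of _ "\<lambda>_. p"]) (simp add: decreases_to_def)
qed

lemma sugeno_integral_mem:
  assumes down: "\<forall>y\<in>Y. \<forall>x\<le>y. x \<in> Y" and "t \<in> Y"
    and "op \<in> Y \<rightarrow> \<mu> ` sets M \<rightarrow> Y" and "D \<inter> {x \<in> space M. f x > t} \<in> sets M"
  shows "lower_sugeno_integral Y op M \<mu> D f \<in> Y"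
proof -
  have "op t (\<mu> (D \<inter> {x \<in> space M. f x > t})) \<in> Y"
    using assms(2-4) by blast
  moreover have "lower_sugeno_integral Y op M \<mu> D f \<le> op t (\<mu> (D \<inter> {x \<in> space M. f x > t}))"
    unfolding lower_sugeno_integral_def using \<open>t \<in> Y\<close> by (rule INF_lower)
  ultimately show ?thesis using down by blast
qed

lemma strict_mono_on_superlevel_set:
  fixes \<phi> :: "'b::linorder \<Rightarrow> 'c::linorder"
  assumes "strict_mono_on Y \<phi>" and "f \<in> space M \<rightarrow> Y" and "a \<in> Y"
  shows "{x \<in> space M. \<phi> (f x) > \<phi> a} = {x \<in> space M. f x > a}"
proof (intro Collect_cong conj_cong refl)
  fix x assume "x \<in> space M"
  then have "f x \<in> Y" using assms(2) by blast
  with assms(1,3) show "\<phi> a < \<phi> (f x) \<longleftrightarrow> a < f x" by (rule strict_mono_on_less)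
qed

lemma inv_into_mono:
  fixes \<phi> :: "'b::linorder \<Rightarrow> 'c::linorder"
  assumes "strict_mono_on Y \<phi>" and "x \<in> \<phi> ` Y" and "y \<in> \<phi> ` Y" and "x \<le> y"
  shows "inv_into Y \<phi> x \<le> inv_into Y \<phi> y"
  using strict_mono_on_less_eq[OF assms(1) inv_into_into[OF assms(2)] inv_into_into[OF assms(3)]]
    assms(2-4) by (simp add: f_inv_into_f)

lemma inv_into_less_iff:
  fixes \<phi> :: "'b::linorder \<Rightarrow> 'c::linorder"
  assumes "strict_mono_on Y \<phi>" and "x \<in> \<phi> ` Y" and "y \<in> Y"
  shows "inv_into Y \<phi> x < y \<longleftrightarrow> x < \<phi> y"
  using strict_mono_on_less[OF assms(1) inv_into_into[OF assms(2)] assms(3)] assms(2)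
  by (simp add: f_inv_into_f)

text \<open>As an order automorphism of \<open>Y\<close>, \<open>\<phi>\<close> turns a strict bound
  on the inverse image of the integral into a strict bound on the infimum itself, which some level
  \<open>t\<close> must then beat. Writing \<open>t = \<phi> a\<close> turns the level sets of
  \<open>\<phi> (f x)\<close> into those of \<open>f\<close>.\<close>

lemma sugeno_integral_approx:
  assumes Y: "\<forall>y\<in>Y. \<forall>x\<le>y. x \<in> Y"
    and op: "op \<in> Y \<rightarrow> \<mu> ` sets M \<rightarrow> Y"
    and \<phi>: "strict_mono_on Y \<phi>" "\<phi> ` Y = Y"
    and f: "f \<in> space M \<rightarrow> Y" "\<And>a. D \<inter> {x \<in> space M. f x > a} \<in> sets M"
    and y: "y \<in> Y" "inv_into Y \<phi> (lower_sugeno_integral Y op M \<mu> D (\<lambda>x. \<phi> (f x))) < y"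
  shows "\<exists>a\<in>Y. inv_into Y \<phi> (op (\<phi> a) (\<mu> (D \<inter> {x \<in> space M. f x > a}))) < y"
proof -
  let ?I = "lower_sugeno_integral Y op M \<mu> D (\<lambda>x. \<phi> (f x))"
  have level: "{x \<in> space M. \<phi> (f x) > \<phi> a} = {x \<in> space M. f x > a}" if "a \<in> Y" for a
    using \<phi>(1) f(1) that by (rule strict_mono_on_superlevel_set)
  have "?I \<in> Y"
    \<comment> \<open>Any level in \<open>Y\<close> can witness membership; at
      \<open>\<phi> y\<close> the level set is \<open>{f > y}\<close>, whose intersection with
      \<open>D\<close> is measurable by assumption.\<close>
    using \<phi>(2) y(1) level[OF y(1)] f(2) by (intro sugeno_integral_mem[OF Y _ op, where t = "\<phi> y"]) auto
  then have "?I < \<phi> y"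
    using y inv_into_less_iff[OF \<phi>(1), of ?I y] \<phi>(2) by simp
  then obtain t where t: "t \<in> Y" "op t (\<mu> (D \<inter> {x \<in> space M. \<phi> (f x) > t})) < \<phi> y"
    unfolding lower_sugeno_integral_def INF_less_iff by blast
  then obtain a where a: "a \<in> Y" "t = \<phi> a" using \<phi>(2) by blast
  have "op (\<phi> a) (\<mu> (D \<inter> {x \<in> space M. f x > a})) \<in> Y"
    using op f(2) a t(1) by blast
  moreover have "op (\<phi> a) (\<mu> (D \<inter> {x \<in> space M. f x > a})) < \<phi> y"
    using t(2) level[OF a(1)] unfolding a(2) by simp
  ultimately show ?thesis
    using a(1) inv_into_less_iff[OF \<phi>(1) _ y(1)] unfolding \<phi>(2) by blast
qed

theorem theorem4:
  fixes M :: "'a measure" and \<mu> :: "'a set \<Rightarrow> ennreal" and D :: "'a set"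
    and m :: ennreal and Y :: "ennreal set"
    and star loz op1 op2 op3 tri :: "ennreal \<Rightarrow> ennreal \<Rightarrow> ennreal"
    and \<phi>1 \<phi>2 \<phi>3 :: "ennreal \<Rightarrow> ennreal"
    and f g :: "'a \<Rightarrow> ennreal"
  assumes "0 < m" and "Y = {0..m} \<or> Y = {0..<m}"
    and "monotone_measure M \<mu>" and "D \<in> sets M"
    and "star \<in> Y \<rightarrow> Y \<rightarrow> Y" and "nondecreasing_op Y Y star"
    and "loz \<in> Y \<rightarrow> Y \<rightarrow> Y" and "nondecreasing_op Y Y loz" and "right_continuous_op Y loz"
    and "op1 \<in> Y \<rightarrow> \<mu> ` sets M \<rightarrow> Y" and "nondecreasing_op Y (\<mu> ` sets M) op1"
    and "op2 \<in> Y \<rightarrow> \<mu> ` sets M \<rightarrow> Y" and "nondecreasing_op Y (\<mu> ` sets M) op2"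
    and "op3 \<in> Y \<rightarrow> \<mu> ` sets M \<rightarrow> Y" and "nondecreasing_op Y (\<mu> ` sets M) op3"
    and "tri \<in> \<mu> ` sets M \<rightarrow> \<mu> ` sets M \<rightarrow> \<mu> ` sets M"
    and "strict_mono_on Y \<phi>1" and "\<phi>1 ` Y = Y"
    and "strict_mono_on Y \<phi>2" and "\<phi>2 ` Y = Y"
    and "strict_mono_on Y \<phi>3" and "\<phi>3 ` Y = Y"
    and "\<And>a b c d. \<lbrakk>a \<in> Y; b \<in> Y; c \<in> \<mu> ` sets M; d \<in> \<mu> ` sets M; c \<le> \<mu> D; d \<le> \<mu> D\<rbrakk> \<Longrightarrow>
           inv_into Y \<phi>1 (op1 (\<phi>1 (star a b)) (tri c d)) \<le>
           loz (inv_into Y \<phi>2 (op2 (\<phi>2 a) c)) (inv_into Y \<phi>3 (op3 (\<phi>3 b) d))"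
    and "f \<in> measurable M (restrict_space borel Y)"
    and "g \<in> measurable M (restrict_space borel Y)"
    and "(\<lambda>x. star (f x) (g x)) \<in> measurable M (restrict_space borel Y)"
    and "mu_subadditive Y M \<mu> tri D f g"
  shows "inv_into Y \<phi>1 (lower_sugeno_integral Y op1 M \<mu> D (\<lambda>x. \<phi>1 (star (f x) (g x)))) \<le>
         loz (inv_into Y \<phi>2 (lower_sugeno_integral Y op2 M \<mu> D (\<lambda>x. \<phi>2 (f x))))
             (inv_into Y \<phi>3 (lower_sugeno_integral Y op3 M \<mu> D (\<lambda>x. \<phi>3 (g x))))"
proof -
  note Y_form = assms(2) and D = assms(4) and tri = assms(16)
    and \<phi>1 = assms(17,18) and \<phi>2 = assms(19,20) and \<phi>3 = assms(21,22)
  \<comment> \<open>Both shapes of \<open>Y\<close> are initial segments of \<open>ennreal\<close>;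
    below, the shape enters only through this and \<open>0 \<in> Y\<close>.\<close>
  have down: "\<forall>y\<in>Y. \<forall>x\<le>y. x \<in> Y"
    using Y_form by auto
  have "0 \<in> Y" using Y_form \<open>0 < m\<close> by auto
  have level: "h \<in> space M \<rightarrow> Y" "\<And>a. D \<inter> {x \<in> space M. h x > a} \<in> sets M"
    if h: "h \<in> measurable M (restrict_space borel Y)" for h
  proof -
    have [measurable]: "h \<in> borel_measurable M" and "h \<in> space M \<rightarrow> Y"
      using h by (auto simp: measurable_restrict_space2_iff)
    then show "h \<in> space M \<rightarrow> Y" by blast
    show "D \<inter> {x \<in> space M. h x > a} \<in> sets M" for a
      using D by measurable
  qed
  note f = level[OF assms(24)] and g = level[OF assms(25)] and fg = level[OF assms(26)]
  let ?F = "\<lambda>a. D \<inter> {x \<in> space M. f x > a}" and ?G = "\<lambda>b. D \<inter> {x \<in> space M. g x > b}"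
  let ?H = "\<lambda>c. D \<inter> {x \<in> space M. star (f x) (g x) > c}"
  let ?u = "\<lambda>a. inv_into Y \<phi>2 (op2 (\<phi>2 a) (\<mu> (?F a)))"
  let ?v = "\<lambda>b. inv_into Y \<phi>3 (op3 (\<phi>3 b) (\<mu> (?G b)))"
  let ?I1 = "lower_sugeno_integral Y op1 M \<mu> D (\<lambda>x. \<phi>1 (star (f x) (g x)))"
  let ?I2 = "lower_sugeno_integral Y op2 M \<mu> D (\<lambda>x. \<phi>2 (f x))"
  let ?I3 = "lower_sugeno_integral Y op3 M \<mu> D (\<lambda>x. \<phi>3 (g x))"
  let ?p = "inv_into Y \<phi>2 ?I2" and ?q = "inv_into Y \<phi>3 ?I3"
  have mu_mono: "\<mu> A \<le> \<mu> B" if "A \<in> sets M" "B \<in> sets M" "A \<subseteq> B" for A B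
    using assms(3) that unfolding monotone_measure_def by (auto dest: mono_onD)
  have int_mem: "lower_sugeno_integral Y op M \<mu> D (\<lambda>x. \<phi> (h x)) \<in> Y"
    if \<phi>: "strict_mono_on Y \<phi>" "\<phi> ` Y = Y" and op: "op \<in> Y \<rightarrow> \<mu> ` sets M \<rightarrow> Y"
      and h: "h \<in> space M \<rightarrow> Y" "\<And>a. D \<inter> {x \<in> space M. h x > a} \<in> sets M" for op \<phi> h
    using \<phi>(2) \<open>0 \<in> Y\<close> strict_mono_on_superlevel_set[OF \<phi>(1) h(1) \<open>0 \<in> Y\<close>] h(2)[of 0]
    by (intro sugeno_integral_mem[OF down _ op, where t = "\<phi> 0"]) auto
  have bound: "inv_into Y \<phi>1 ?I1 \<le> loz (?u a) (?v b)" if ab: "a \<in> Y" "b \<in> Y" for a b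
  proof -
    let ?c = "star a b"
    have c: "?c \<in> Y" "\<phi>1 ?c \<in> Y" using assms(5) ab \<phi>1(2) by blast+
    have sub: "?H ?c \<subseteq> ?F a \<union> ?G b"
    proof
      fix x assume x: "x \<in> ?H ?c"
      then have "f x \<in> Y" "g x \<in> Y" using f(1) g(1) by auto
      then have "star (f x) (g x) \<le> ?c" if "f x \<le> a" "g x \<le> b"
        using assms(6) ab that unfolding nondecreasing_op_def by blast
      \<comment> \<open>By contraposition: outside both level sets the bound just shown contradicts
        \<open>star (f x) (g x) > ?c\<close>.\<close>
      then show "x \<in> ?F a \<union> ?G b" using x by (auto simp: not_le[symmetric])
    qed
    have Un: "?F a \<union> ?G b = D \<inter> ({x \<in> space M. f x > a} \<union> {x \<in> space M. g x > b})"
      by blast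
    have "\<mu> (?H ?c) \<le> \<mu> (?F a \<union> ?G b)"
      using fg(2) f(2) g(2) sub by (intro mu_mono sets.Un)
    also have "\<dots> \<le> tri (\<mu> (?F a)) (\<mu> (?G b))"
      unfolding Un using assms(27) ab by (simp add: mu_subadditive_def)
    finally have le: "\<mu> (?H ?c) \<le> tri (\<mu> (?F a)) (\<mu> (?G b))" .
    have mem: "\<mu> (?H ?c) \<in> \<mu> ` sets M" "\<mu> (?F a) \<in> \<mu> ` sets M" "\<mu> (?G b) \<in> \<mu> ` sets M"
      using fg(2) f(2) g(2) by blast+
    then have tri_mem: "tri (\<mu> (?F a)) (\<mu> (?G b)) \<in> \<mu> ` sets M"
      using tri by blast
    have "?I1 \<le> op1 (\<phi>1 ?c) (\<mu> (D \<inter> {x \<in> space M. \<phi>1 (star (f x) (g x)) > \<phi>1 ?c}))"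
      unfolding lower_sugeno_integral_def using c(2) by (rule INF_lower)
    also have "\<dots> = op1 (\<phi>1 ?c) (\<mu> (?H ?c))"
      using strict_mono_on_superlevel_set[OF \<phi>1(1) fg(1) c(1)] by simp
    also have "\<dots> \<le> op1 (\<phi>1 ?c) (tri (\<mu> (?F a)) (\<mu> (?G b)))"
      using assms(11) c(2) mem(1) tri_mem le unfolding nondecreasing_op_def by blast
    finally have "?I1 \<le> op1 (\<phi>1 ?c) (tri (\<mu> (?F a)) (\<mu> (?G b)))" .
    moreover have "op1 (\<phi>1 ?c) (tri (\<mu> (?F a)) (\<mu> (?G b))) \<in> Y"
      using assms(10) c(2) tri_mem by blast
    moreover have "?I1 \<in> Y"
      using int_mem[OF \<phi>1 assms(10) fg] .
    ultimately have "inv_into Y \<phi>1 ?I1 \<le> inv_into Y \<phi>1 (op1 (\<phi>1 ?c) (tri (\<mu> (?F a)) (\<mu> (?G b))))"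
      using \<phi>1 by (intro inv_into_mono) auto
    also have "\<dots> \<le> loz (?u a) (?v b)"
      \<comment> \<open>The side conditions \<open>c \<le> \<mu> D\<close> and
        \<open>d \<le> \<mu> D\<close> hold because \<open>?F a\<close> and \<open>?G b\<close> are
        subsets of \<open>D\<close>.\<close>
      using ab mem f(2) g(2) D by (intro assms(23) mu_mono) auto
    finally show ?thesis .
  qed
  have u_mem: "?u a \<in> Y" if "a \<in> Y" for a
  proof (rule inv_into_into)
    have "\<phi>2 a \<in> Y" using \<phi>2(2) that by blast
    then show "op2 (\<phi>2 a) (\<mu> (?F a)) \<in> \<phi>2 ` Y"
      unfolding \<phi>2(2) using assms(12) f(2) by blast
  qed
  have v_mem: "?v b \<in> Y" if "b \<in> Y" for b
  proof (rule inv_into_into)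
    have "\<phi>3 b \<in> Y" using \<phi>3(2) that by blast
    then show "op3 (\<phi>3 b) (\<mu> (?G b)) \<in> \<phi>3 ` Y"
      unfolding \<phi>3(2) using assms(14) g(2) by blast
  qed
  have p: "?p \<in> Y" and q: "?q \<in> Y"
    using int_mem[OF \<phi>2 assms(12) f] int_mem[OF \<phi>3 assms(14) g] \<phi>2(2) \<phi>3(2)
    by (simp_all add: inv_into_into)
  obtain s where s: "\<And>n. s n \<in> Y" "decreases_to Y s ?p"
      "(\<forall>n. ?p < s n) \<or> (\<forall>n y. y \<in> Y \<longrightarrow> y \<le> s n)"
    using decreases_to_exists[OF down p] by blast
  obtain t where t: "\<And>n. t n \<in> Y" "decreases_to Y t ?q"
      "(\<forall>n. ?q < t n) \<or> (\<forall>n y. y \<in> Y \<longrightarrow> y \<le> t n)"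
    using decreases_to_exists[OF down q] by blast
  have "inv_into Y \<phi>1 ?I1 \<le> loz (s n) (t n)" for n
  proof -
    \<comment> \<open>If \<open>?p < s n\<close>, the approximation lemma yields \<open>a\<close>.
      Otherwise \<open>s n\<close> bounds all of \<open>Y\<close>, and \<open>a = 0\<close> will
      do.\<close>
    have "\<exists>a\<in>Y. ?u a \<le> s n"
      using s(3) sugeno_integral_approx[OF down assms(12) \<phi>2 f s(1)[of n]] u_mem \<open>0 \<in> Y\<close>
      by (meson less_imp_le)
    then obtain a where a: "a \<in> Y" "?u a \<le> s n" by blast
    have "\<exists>b\<in>Y. ?v b \<le> t n"
      using t(3) sugeno_integral_approx[OF down assms(14) \<phi>3 g t(1)[of n]] v_mem \<open>0 \<in> Y\<close>
      by (meson less_imp_le)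
    then obtain b where b: "b \<in> Y" "?v b \<le> t n" by blast
    have "loz (?u a) (?v b) \<le> loz (s n) (t n)"
      using assms(8) u_mem[OF a(1)] v_mem[OF b(1)] s(1)[of n] t(1)[of n] a(2) b(2)
      unfolding nondecreasing_op_def by blast
    with bound[OF a(1) b(1)] show ?thesis by (rule order_trans)
  qed
  \<comment> \<open>Both coordinates descend together, even if one of the sequences is constant; the
    left-hand side, a lower bound for every term, then bounds the limit.\<close>
  moreover have "(\<lambda>n. loz (s n) (t n)) \<longlonglongrightarrow> loz ?p ?q"
    using assms(9) s(1,2) t(1,2) p q unfolding right_continuous_op_def by blast
  ultimately show ?thesis
    by (intro LIMSEQ_le_const) auto
qed

end
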